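(* If $f\in\mathcal{S}^*_{S}$, then $f\in\Omega$ in the disc $|z|<r_0$, i.e. $|zf'(z)-f(z)|<\frac12$ for all $|z|<r_0$, where $r_0\approx0.531721$ is the smallest positive root of $2\sinh(r)f_0(r)-1=0$ and $$f_0(z)=z\exp\left(\int_0^z\frac{\sin t}{t}\,dt\right).$$
   Context: $\mathbb{D}=\{z\in\mathbb{C}:|z|<1\}$. $\mathcal{A}$ is the class of analytic functions $f$ on $\mathbb{D}$ with $f(0)=0$, $f'(0)=1$. $\Omega=\{f\in\mathcal{A}:|zf'(z)-f(z)|<\frac12,\ z\in\mathbb{D}\}$; "$f\in\Omega$ in the disc $|z|<r_0$" means that the defining inequality holds for all $|z|<r_0$. $\mathcal{S}^*_{S}$ is the class of $f\in\mathcal{A}$ with $zf'(z)/f(z)\prec 1+\sin z$, where $p\prec\phi$ means $p=\phi\circ\omega$ for some analytic $\omega:\mathbb{D}\to\mathbb{D}$ with $\omega(0)=0$. *)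

theory Defs
  imports "HOL-Complex_Analysis.Complex_Analysis"
begin

definition unit_disc :: "complex set" where
  "unit_disc = ball 0 1"

definition class_A :: "(complex \<Rightarrow> complex) set" where
  "class_A = {f. f holomorphic_on unit_disc \<and> f 0 = 0 \<and> deriv f 0 = 1}"

definition Omega_in_disc :: "real \<Rightarrow> (complex \<Rightarrow> complex) set" where
  "Omega_in_disc r = {f \<in> class_A. \<forall>z \<in> ball 0 r. norm (z * deriv f z - f z) < 1 / 2}"

definition class_Omega :: "(complex \<Rightarrow> complex) set" where
  "class_Omega = Omega_in_disc 1"

definition subordinate :: "(complex \<Rightarrow> complex) \<Rightarrow> (complex \<Rightarrow> complex) \<Rightarrow> bool" where
  "subordinate p \<phi> \<longleftrightarrow>
     (\<exists>\<omega>. \<omega> holomorphic_on unit_disc \<and> \<omega> ` unit_disc \<subseteq> unit_disc \<and> \<omega> 0 = 0 \<and>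
          (\<forall>z \<in> unit_disc. p z = \<phi> (\<omega> z)))"

(* The quotient z f'(z) / f(z) with its removable singularity at 0 filled in:
   for f in class A its limit at 0 is 1. *)
definition starlike_quotient :: "(complex \<Rightarrow> complex) \<Rightarrow> complex \<Rightarrow> complex" where
  "starlike_quotient f z = (if z = 0 then 1 else z * deriv f z / f z)"

(* At a zero of f other than 0 the quotient would be x / 0 = 0.  The subordination
   excludes this, because 1 + sin w has no zero with |w| < 1; so, as usual,
   membership forces f to be nonzero on the punctured disc. *)
definition class_S_sin :: "(complex \<Rightarrow> complex) set" where
  "class_S_sin = {f \<in> class_A. subordinate (starlike_quotient f) (\<lambda>z. 1 + sin z)}"

(* The integrand is entire up to its removable singularity at 0, so the integral
   from 0 to z may be taken along the segment; the value at t = 0 is irrelevant. *)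
definition f0 :: "complex \<Rightarrow> complex" where
  "f0 z = z * exp (contour_integral (linepath 0 z) (\<lambda>t. sin t / t))"

definition smallest_positive_root :: "(real \<Rightarrow> complex) \<Rightarrow> real \<Rightarrow> bool" where
  "smallest_positive_root g r \<longleftrightarrow> 0 < r \<and> g r = 0 \<and> (\<forall>s. 0 < s \<and> s < r \<longrightarrow> g s \<noteq> 0)"

end

theory Submission
  imports Defs "HOL-Probability.Sinc_Integral"
begin

text \<open>
  Write \<open>z f'(z) = f(z) (1 + sin (\<omega> z))\<close>. By the Schwarz lemma \<open>|\<omega> z| \<le> |z|\<close>, so
  \<open>|z f'(z) - f(z)| \<le> |f(z)| sinh |z|\<close>. On the disc \<open>|w| \<le> t\<close> with \<open>t \<le> 3/5\<close> the
  maximum of \<open>Re (sin w)\<close> is \<open>sin t\<close>; hence, for \<open>|\<zeta>| = 1\<close>, the function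
  \<open>|f (t \<zeta>)|\<^sup>2 exp (- 2 Si t) / t\<^sup>2\<close> is nonincreasing in \<open>t\<close>, and as it tends to 1 at 0 we
  get \<open>|f(z)| \<le> |z| exp (Si |z|)\<close>. Both bounds increase with \<open>|z|\<close>, and their product
  equals \<open>1/2\<close> exactly at the root.
\<close>

section \<open>Bounds for the complex sine on a disc\<close>

text \<open>The series of \<open>sinh\<close> has the absolute values of the coefficients of
  \<open>sin\<close>, so it majorizes termwise.\<close>

lemma norm_sin_le_sinh_norm: "norm (sin z) \<le> sinh (norm z)" for z :: complex
proof (rule norm_sums_le[OF sin_converges sinh_converges])
  show "norm (sin_coeff n *\<^sub>R z ^ n) \<le> (if even n then 0 else norm z ^ n /\<^sub>R fact n)" for n
    by (auto simp: sin_coeff_def norm_power norm_mult field_simps)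
qed

lemma sinh_le_mult_cosh:
  fixes y :: real
  assumes "0 \<le> y"
  shows "sinh y \<le> y * cosh y"
proof -
  have "0 * cosh 0 - sinh 0 \<le> y * cosh y - sinh y"
    by (rule DERIV_nonneg_imp_nondecreasing[OF assms])
      (auto intro!: exI derivative_eq_intros)
  then show ?thesis by simp
qed

lemma Re_sin_cosh: "Re (sin z) = sin (Re z) * cosh (Im z)"
  by (simp add: Re_sin cosh_field_def)

text \<open>With x = \<rho> cos \<theta> and y = \<rho> sin \<theta> the left side is the real part
  of \<open>sin\<close> at the point with polar coordinates \<rho>, \<theta>. Its derivative in
  \<theta> is x sin x sinh y - y cos x cosh y. This is nonpositive because x sin x \<le> cos x and
  sinh y \<le> y cosh y, so on a quarter circle the maximum is at \<theta> = 0.\<close>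

lemma Re_sin_polar_le:
  fixes \<rho> \<theta> :: real
  assumes \<rho>: "0 \<le> \<rho>" "\<rho> \<le> 3/5" and \<theta>: "0 \<le> \<theta>" "\<theta> \<le> pi / 2"
  shows "sin (\<rho> * cos \<theta>) * cosh (\<rho> * sin \<theta>) \<le> sin \<rho>"
proof -
  have "sin (\<rho> * cos \<theta>) * cosh (\<rho> * sin \<theta>) \<le> sin (\<rho> * cos 0) * cosh (\<rho> * sin 0)"
  proof (rule DERIV_nonpos_imp_nonincreasing[OF \<theta>(1)])
    fix a :: real assume a: "0 \<le> a" "a \<le> \<theta>"
    define x y where "x = \<rho> * cos a" and "y = \<rho> * sin a"
    have ca: "0 \<le> cos a" "cos a \<le> 1" "0 \<le> sin a"
      using a \<theta> by (auto intro!: cos_ge_zero sin_ge_zero)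
    have x: "0 \<le> x" "x \<le> 3/5" and y: "0 \<le> y"
      using ca \<rho> mult_mono[of \<rho> "3/5" "cos a" 1] by (auto simp: x_def y_def)
    have "sin x \<le> x" by (rule sin_x_le_x[OF x(1)])
    then have "x * sin x \<le> (3/5) * (3/5)" using x pi_gt3 by (intro mult_mono) (auto intro!: sin_ge_zero)
    \<comment> \<open>The bound \<open>3/5\<close> enters here: its square 9/25 is below 1/2 = cos
      (pi/3), and x \<le> 3/5 < pi/3.\<close>
    also have "\<dots> \<le> cos (pi / 3)" by (simp add: cos_60)
    also have "\<dots> \<le> cos x" using x pi_gt3 by (intro cos_monotone_0_pi_le) auto
    finally have 1: "x * sin x \<le> cos x" .
    have 2: "sinh y \<le> y * cosh y" by (rule sinh_le_mult_cosh[OF y])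
    have "x * sin x * sinh y \<le> cos x * (y * cosh y)"
      using 1 2 y x pi_gt3 by (intro mult_mono) (auto intro!: cos_ge_zero)
    then have "x * sin x * sinh y - y * cos x * cosh y \<le> 0" by (simp add: algebra_simps)
    moreover have "((\<lambda>a. sin (\<rho> * cos a) * cosh (\<rho> * sin a)) has_real_derivative
        (x * sin x * sinh y - y * cos x * cosh y)) (at a)"
      unfolding x_def y_def by (auto intro!: derivative_eq_intros simp: algebra_simps)
    ultimately show "\<exists>d. ((\<lambda>a. sin (\<rho> * cos a) * cosh (\<rho> * sin a)) has_real_derivative d) (at a) \<and> d \<le> 0"
      by blast
  qed
  then show ?thesis by simp
qed

text \<open>In the left half of the disc the real part is nonpositive. In the right half, evenness
  of \<open>cosh\<close> allows replacing \<open>Im w\<close> by its absolute value, which leads to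
  the first quadrant and the polar estimate.\<close>

lemma Re_sin_le_sin:
  fixes w :: complex
  assumes w: "norm w \<le> t" and t: "t \<le> 3/5"
  shows "Re (sin w) \<le> sin t"
proof (cases "Re w \<le> 0")
  case True
  have "\<bar>Re w\<bar> \<le> 3/5" using abs_Re_le_cmod[of w] w t by linarith
  then have "sin (Re w) \<le> 0"
    using True pi_gt3 sin_ge_zero[of "- Re w"] by simp
  then have "Re (sin w) \<le> 0"
    by (simp add: Re_sin_cosh mult_nonpos_nonneg)
  also have "0 \<le> sin t"
    using order_trans[OF norm_ge_zero w] t pi_gt3 by (intro sin_ge_zero) auto
  finally show ?thesis .
next
  case False
  define \<rho> where "\<rho> = norm w"
  have \<rho>: "0 < \<rho>" using False by (auto simp: \<rho>_def)
  have "(Re w / \<rho>)\<^sup>2 + (\<bar>Im w\<bar> / \<rho>)\<^sup>2 = 1"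
    using \<rho> by (simp add: power_divide add_divide_distrib[symmetric] \<rho>_def cmod_power2[symmetric])
  then obtain \<theta> where \<theta>: "0 \<le> \<theta>" "\<theta> \<le> pi / 2" "Re w / \<rho> = cos \<theta>" "\<bar>Im w\<bar> / \<rho> = sin \<theta>"
    using sincos_total_pi_half[of "Re w / \<rho>" "\<bar>Im w\<bar> / \<rho>"] False \<rho> by auto
  have "Re (sin w) = sin (Re w) * cosh \<bar>Im w\<bar>" by (simp add: Re_sin_cosh)
  also have "\<dots> = sin (\<rho> * cos \<theta>) * cosh (\<rho> * sin \<theta>)"
    using \<rho> by (simp add: \<theta>(3,4)[symmetric])
  also have "\<dots> \<le> sin \<rho>"
    using \<theta> \<rho> w t by (intro Re_sin_polar_le) (auto simp: \<rho>_def)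
  also have "\<dots> \<le> sin t"
    using w t \<rho> pi_gt3 unfolding \<rho>_def[symmetric] by (intro sin_monotone_2pi_le) linarith+
  finally show ?thesis .
qed

section \<open>The sine integral and numerical bounds\<close>

lemma Si_0: "Si 0 = 0"
  using Si_neg[of 0] by simp

lemma f0_of_real:
  fixes r :: real
  assumes "0 < r"
  shows "f0 (of_real r) = of_real (r * exp (Si r))"
proof -
  have "(sinc has_integral (Si r - Si 0)) {0..r}"
  proof (rule fundamental_theorem_of_calculus)
    show "(Si has_vector_derivative sinc x) (at x within {0..r})" for x
      by (rule has_vector_derivative_at_within)
        (rule DERIV_Si[unfolded has_real_derivative_iff_has_vector_derivative])
  qed (use assms in simp)
  then have "((\<lambda>x. of_real (sinc x)) has_integral (of_real (Si r) :: complex)) {0..r}"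
    unfolding Si_0 diff_0_right by (rule has_integral_of_real)
  \<comment> \<open>The integrands differ only at 0, where \<open>sinc\<close> is 1 but the quotient
    0/0 is 0.\<close>
  then have "((\<lambda>x. sin (of_real x) / of_real x) has_integral (of_real (Si r) :: complex)) {0..r}"
    by (rule has_integral_spike_finite[of "{0}", rotated 2]) (auto simp: sin_of_real)
  then have "((\<lambda>t. sin t / t) has_contour_integral of_real (Si r)) (linepath 0 (of_real r))"
    using assms by (subst has_contour_integral_linepath_Reals_iff) auto
  then show ?thesis
    by (simp add: f0_def contour_integral_unique exp_of_real)
qed

text \<open>The Taylor estimate of \<open>sinc\<close>, integrated: the denominators are n * n! for
  n = 3, 5, 7, 9. Each one-sided bound is monotonicity of a difference that vanishes at 0.\<close>

lemma Si_bounds: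
  fixes x :: real
  assumes "0 \<le> x"
  shows "\<bar>Si x - (x - x^3/18 + x^5/600 - x^7/35280)\<bar> \<le> x^9/3265920"
proof -
  have sinc: "\<bar>sinc t - (1 - t^2/6 + t^4/120 - t^6/5040)\<bar> \<le> t^8/362880" if "0 \<le> t" for t
  proof (cases "t = 0")
    case False
    then have t: "0 < t" using that by simp
    have "\<bar>sin t - (t - t^3/6 + t^5/120 - t^7/5040)\<bar> \<le> t^9/362880"
      using Maclaurin_sin_bound[of t 9] t
      by (simp add: lessThan_nat_numeral sin_coeff_def fact_numeral algebra_simps)
    then have "\<bar>t * (sinc t - (1 - t^2/6 + t^4/120 - t^6/5040))\<bar> \<le> t * (t^8/362880)"
      using t by (simp add: algebra_simps eval_nat_numeral)
    then show ?thesis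
      using t unfolding abs_mult by simp
  qed simp
  have "Si 0 - (0 - 0^3/18 + 0^5/600 - 0^7/35280 + 0^9/3265920)
      \<ge> Si x - (x - x^3/18 + x^5/600 - x^7/35280 + x^9/3265920)"
  proof (rule DERIV_nonpos_imp_nonincreasing[OF assms])
    fix t :: real assume t: "0 \<le> t"
    show "\<exists>d. ((\<lambda>x. Si x - (x - x^3/18 + x^5/600 - x^7/35280 + x^9/3265920))
        has_real_derivative d) (at t) \<and> d \<le> 0"
    proof (intro exI conjI)
      show "((\<lambda>x. Si x - (x - x^3/18 + x^5/600 - x^7/35280 + x^9/3265920))
          has_real_derivative sinc t - (1 - t^2/6 + t^4/120 - t^6/5040 + t^8/362880)) (at t)"
        by (rule DERIV_diff[OF DERIV_Si]) (auto intro!: derivative_eq_intros)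
      show "sinc t - (1 - t^2/6 + t^4/120 - t^6/5040 + t^8/362880) \<le> 0"
        using sinc[OF t] unfolding abs_le_iff by linarith
    qed
  qed
  moreover have "Si 0 - (0 - 0^3/18 + 0^5/600 - 0^7/35280 - 0^9/3265920)
      \<le> Si x - (x - x^3/18 + x^5/600 - x^7/35280 - x^9/3265920)"
  proof (rule DERIV_nonneg_imp_nondecreasing[OF assms])
    fix t :: real assume t: "0 \<le> t"
    show "\<exists>d. ((\<lambda>x. Si x - (x - x^3/18 + x^5/600 - x^7/35280 - x^9/3265920))
        has_real_derivative d) (at t) \<and> d \<ge> 0"
    proof (intro exI conjI)
      show "((\<lambda>x. Si x - (x - x^3/18 + x^5/600 - x^7/35280 - x^9/3265920))
          has_real_derivative sinc t - (1 - t^2/6 + t^4/120 - t^6/5040 - t^8/362880)) (at t)"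
        by (rule DERIV_diff[OF DERIV_Si]) (auto intro!: derivative_eq_intros)
      show "sinc t - (1 - t^2/6 + t^4/120 - t^6/5040 - t^8/362880) \<ge> 0"
        using sinc[OF t] unfolding abs_le_iff by linarith
    qed
  qed
  ultimately show ?thesis unfolding abs_le_iff by (simp add: Si_0)
qed

text \<open>Lagrange remainder, with exp t \<le> e \<le> 3 at the intermediate point.\<close>

lemma exp_Taylor_bounds:
  fixes x :: real
  assumes "0 \<le> x" "x \<le> 1"
  shows "(\<Sum>m<n. x^m / fact m) \<le> exp x" "exp x \<le> (\<Sum>m<n. x^m / fact m) + 3 / fact n * x^n"
proof -
  obtain t where t: "\<bar>t\<bar> \<le> \<bar>x\<bar>" and e: "exp x = (\<Sum>m<n. x^m / fact m) + exp t / fact n * x^n"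
    using Maclaurin_exp_le by blast
  have "exp t \<le> exp 1" using t assms by simp
  then have "exp t \<le> 3" using exp_le by linarith
  then have "exp t / fact n * x^n \<le> 3 / fact n * x^n"
    using assms by (intro mult_right_mono divide_right_mono) auto
  moreover have "0 \<le> exp t / fact n * x^n" using assms by simp
  ultimately show "(\<Sum>m<n. x^m / fact m) \<le> exp x" "exp x \<le> (\<Sum>m<n. x^m / fact m) + 3 / fact n * x^n"
    using e by linarith+
qed

section \<open>The radius equation and its root\<close>

text \<open>By \<open>f0_of_real\<close> this is 2 sinh(r) f0(r) for r > 0, so the root equation
  reads \<open>radius_fun r = 1\<close>.\<close>

definition radius_fun :: "real \<Rightarrow> real" where
  "radius_fun r = 2 * sinh r * (r * exp (Si r))"

lemma Si_strict_mono_01: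
  assumes "0 \<le> r" "r < s" "s \<le> 1"
  shows "Si r < Si s"
proof (rule DERIV_pos_imp_increasing[OF assms(2)])
  fix x assume "r \<le> x" "x \<le> s"
  then have "0 < sinc x" using assms pi_gt3 sin_gt_zero[of x] by auto
  then show "\<exists>y. (Si has_real_derivative y) (at x) \<and> 0 < y"
    using DERIV_Si by blast
qed

text \<open>Used twice: to exclude roots below \<open>r0\<close>, and to make the final bound 1/2
  strict.\<close>

lemma radius_fun_strict_mono:
  assumes "0 \<le> r" "r < s" "s \<le> 1"
  shows "radius_fun r < radius_fun s"
proof -
  have "r * exp (Si r) < s * exp (Si s)"
    using assms Si_strict_mono_01[OF assms] by (intro mult_strict_mono') auto
  moreover have "2 * sinh r < 2 * sinh s" using assms by simp
  ultimately show ?thesis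
    unfolding radius_fun_def using assms by (rule_tac mult_strict_mono') auto
qed

lemma radius_fun_root:
  obtains r0 where "radius_fun r0 = 1" "\<bar>r0 - 0.531721\<bar> < 5 / 10 ^ 7"
proof -
  \<comment> \<open>These are 0.531721 -+ 5/10^7. The function grows by only about 5/10^6 between
    them, so the bounds below carry about eight decimals; ten Taylor terms of \<open>exp\<close>
    leave an error below 1/10^8.\<close>
  define a b :: real where "a = 0.5317205" and "b = 0.5317215"
  have lo: "radius_fun a < 1"
  proof -
    have "Si a \<le> 0.52343925"
      using Si_bounds[of a] unfolding abs_le_iff by (simp add: a_def power_divide)
    then have "exp (Si a) \<le> exp 0.52343925" by simp
    also have "\<dots> \<le> 1.68782253"
      using exp_Taylor_bounds(2)[of "0.52343925" 10]
      by (simp add: lessThan_nat_numeral fact_numeral power_divide)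
    finally have 1: "exp (Si a) \<le> 1.68782253" .
    have 2: "exp a \<le> 1.70185784"
      using exp_Taylor_bounds(2)[of a 10]
      by (simp add: a_def lessThan_nat_numeral fact_numeral power_divide)
    \<comment> \<open>The upper bound for exp a also bounds exp (-a) below, so it alone controls
      sinh a.\<close>
    then have "inverse 1.70185784 \<le> exp (- a)"
      unfolding exp_minus by (intro le_imp_inverse_le) auto
    with 2 have "sinh a \<le> 0.55713235"
      by (simp add: sinh_field_def)
    then have "2 * sinh a * (a * exp (Si a)) \<le> 2 * 0.55713235 * (a * 1.68782253)"
      using 1 by (intro mult_mono) (auto simp: a_def)
    also have "\<dots> < 1" by (simp add: a_def)
    finally show ?thesis by (simp add: radius_fun_def)
  qed
  have hi: "1 < radius_fun b"
  proof -
    have "1.68782410 \<le> exp (0.52344019 :: real)"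
      using exp_Taylor_bounds(1)[of "0.52344019" 10]
      by (simp add: lessThan_nat_numeral fact_numeral power_divide)
    also have "0.52344019 \<le> Si b"
      using Si_bounds[of b] unfolding abs_le_iff by (simp add: b_def power_divide)
    then have "exp 0.52344019 \<le> exp (Si b)" by simp
    finally have 1: "1.68782410 \<le> exp (Si b)" .
    have 2: "1.70185953 \<le> exp b"
      using exp_Taylor_bounds(1)[of b 10]
      by (simp add: b_def lessThan_nat_numeral fact_numeral power_divide)
    then have "exp (- b) \<le> inverse 1.70185953"
      unfolding exp_minus by (intro le_imp_inverse_le) auto
    with 2 have 3: "0.55713348 \<le> sinh b"
      by (simp add: sinh_field_def)
    have "1 < 2 * 0.55713348 * (b * 1.68782410)" by (simp add: b_def)
    also have "\<dots> \<le> 2 * sinh b * (b * exp (Si b))"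
      using 1 3 by (intro mult_mono) (auto simp: b_def)
    finally show ?thesis by (simp add: radius_fun_def)
  qed
  have "isCont radius_fun x" for x
    unfolding radius_fun_def by (intro continuous_intros isCont_Si isCont_o2[OF isCont_Si])
  then obtain r0 where r0: "a \<le> r0" "r0 \<le> b" "radius_fun r0 = 1"
    using IVT[of radius_fun a 1 b] lo hi by (auto simp: a_def b_def)
  \<comment> \<open>Excluding the endpoints makes the error bound strict.\<close>
  then have "r0 \<noteq> a" "r0 \<noteq> b" using lo hi by auto
  then have "\<bar>r0 - 0.531721\<bar> < 5 / 10 ^ 7"
    using r0 unfolding abs_less_iff by (simp add: a_def b_def)
  then show ?thesis using that r0 by blast
qed

section \<open>Growth of f along a radius\<close>

text \<open>Here \<open>q\<close> stands for \<open>sin\<close> composed with \<omega>. Formally,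
  the logarithm of |f(t\<zeta>)| has derivative (1 + Re q)/t \<le> 1/t + sin t / t, which integrates
  to the claim. Working with the squared modulus \<psi> avoids the logarithm.\<close>

lemma norm_le_of_starlike_quotient:
  assumes f: "f holomorphic_on ball 0 1" "f 0 = 0" "deriv f 0 = 1"
    and z: "z \<noteq> 0" "norm z < 1"
    and q: "\<And>u. u \<noteq> 0 \<Longrightarrow> norm u \<le> norm z \<Longrightarrow> u * deriv f u = f u * (1 + q u)"
    and Re_q: "\<And>u. norm u \<le> norm z \<Longrightarrow> Re (q u) \<le> sin (norm u)"
  shows "norm (f z) \<le> norm z * exp (Si (norm z))"
proof -
  define r where "r = norm z"
  define \<zeta> where "\<zeta> = sgn z"
  have r: "0 < r" "r < 1" and \<zeta>: "norm \<zeta> = 1" and z_eq: "z = of_real r * \<zeta>"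
    using z by (auto simp: r_def \<zeta>_def norm_sgn) (simp add: sgn_div_norm scaleR_conv_of_real)
  define g where "g = (\<lambda>t. f (of_real t * \<zeta>))"
  define \<psi> where "\<psi> = (\<lambda>t. ((Re (g t))\<^sup>2 + (Im (g t))\<^sup>2) * exp (- 2 * Si t) / t\<^sup>2)"
  have \<psi>_eq: "\<psi> t = (norm (g t / of_real t))\<^sup>2 * exp (- 2 * Si t)" for t
    by (simp add: \<psi>_def cmod_power2[symmetric] norm_divide power_divide)
  have "\<psi> r \<le> \<psi> s" if s: "0 < s" "s \<le> r" for s
  proof (rule DERIV_nonpos_imp_nonincreasing[OF s(2)])
    fix t assume t: "s \<le> t" "t \<le> r"
    define u where "u = of_real t * \<zeta>"
    define N g' where "N = (Re (g t))\<^sup>2 + (Im (g t))\<^sup>2" and "g' = \<zeta> * deriv f u"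
    have u: "norm u = t" "u \<noteq> 0" "0 < t" using t s \<zeta> by (auto simp: u_def norm_mult)
    have "(f has_field_derivative deriv f u) (at u)"
      using f(1) u t r by (intro holomorphic_derivI[of _ "ball 0 1"]) auto
    then have "(g has_vector_derivative g') (at t)"
      unfolding g_def g'_def u_def
      by (intro derivative_eq_intros has_vector_derivative_real_field
          field_vector_diff_chain_at[unfolded o_def]) auto
    then have dRe: "((\<lambda>t. Re (g t)) has_real_derivative Re g') (at t)"
      and dIm: "((\<lambda>t. Im (g t)) has_real_derivative Im g') (at t)"
      by (auto simp: has_real_derivative_iff_has_vector_derivative
          intro: bounded_linear.has_vector_derivative bounded_linear_Re bounded_linear_Im)
    define D where "D = 2 * (Re (g t) * Re g' + Im (g t) * Im g')"
    have "of_real t * g' = g t * (1 + q u)"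
      using q[of u] u t by (simp add: g_def g'_def u_def r_def mult_ac)
    \<comment> \<open>Multiplying by the conjugate of g turns the left side into t * D / 2, where D
      is the derivative of N = |g|^2.\<close>
    then have "Re (cnj (g t) * (of_real t * g')) = Re (cnj (g t) * (g t * (1 + q u)))" by simp
    also have "\<dots> = N * (1 + Re (q u))"
      by (simp add: N_def power2_eq_square algebra_simps)
    also have "\<dots> \<le> N * (1 + sin t)"
      using Re_q[of u] u t by (intro mult_left_mono) (auto simp: r_def N_def)
    finally have "t * D - 2 * N * sin t - 2 * N \<le> 0"
      by (simp add: D_def algebra_simps)
    then have "(t * D - 2 * N * sin t - 2 * N) * exp (- 2 * Si t) / t^3 \<le> 0"
      using u by (intro divide_nonpos_nonneg mult_nonpos_nonneg) auto
    moreover have "(\<psi> has_real_derivative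
        (t * D - 2 * N * sin t - 2 * N) * exp (- 2 * Si t) / t^3) (at t)"
    proof -
      have dN: "((\<lambda>t. (Re (g t))\<^sup>2 + (Im (g t))\<^sup>2) has_real_derivative D) (at t)"
        by (rule DERIV_cong[OF DERIV_add[OF DERIV_power[OF dRe] DERIV_power[OF dIm]]])
          (simp add: D_def)
      have "(Si has_real_derivative sin t / t) (at t)"
        using DERIV_Si[of t] u(3) by simp
      then have dE: "((\<lambda>t. exp (- 2 * Si t)) has_real_derivative
          exp (- 2 * Si t) * (- 2 * (sin t / t))) (at t)"
        by (rule DERIV_fun_exp[OF DERIV_cmult])
      have dP: "((\<lambda>t. t\<^sup>2) has_real_derivative 2 * t) (at t)"
        by (rule DERIV_cong[OF DERIV_pow]) simp
      have "(D * exp (- 2 * Si t) + exp (- 2 * Si t) * (- 2 * (sin t / t)) * N) * t\<^sup>2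
          - N * exp (- 2 * Si t) * (2 * t)
        = (t * D - 2 * N * sin t - 2 * N) * exp (- 2 * Si t) * t"
        using u(3) by (simp add: algebra_simps power2_eq_square)
      then have "((D * exp (- 2 * Si t) + exp (- 2 * Si t) * (- 2 * (sin t / t)) * N) * t\<^sup>2
          - N * exp (- 2 * Si t) * (2 * t)) / (t\<^sup>2 * t\<^sup>2)
        = (t * D - 2 * N * sin t - 2 * N) * exp (- 2 * Si t) / t^3"
        using u(3) by (simp add: power2_eq_square power3_eq_cube)
      then show ?thesis
        using u(3) unfolding \<psi>_def N_def
        by (intro DERIV_cong[OF DERIV_divide[OF DERIV_mult[OF dN dE] dP]]) (assumption | simp)+
    qed
    ultimately show "\<exists>d. (\<psi> has_real_derivative d) (at t) \<and> d \<le> 0" by blast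
  qed
  \<comment> \<open>At 0 the formula for \<psi> gives the default value 0 of division by zero, so
    the comparison uses the right-hand limit, which is 1 because f(h)/h tends to f'(0) = 1.\<close>
  then have ev: "eventually (\<lambda>s. \<psi> r \<le> \<psi> s) (at_right 0)"
    using r by (auto simp: eventually_at_right_field intro!: exI[of _ r])
  have "(f has_field_derivative 1) (at 0)"
    using holomorphic_derivI[OF f(1), of 0] f(3) by simp
  then have "((\<lambda>h. f h / h) \<longlongrightarrow> 1) (at 0)"
    using f(2) by (simp add: DERIV_def)
  moreover have "filterlim (\<lambda>s. of_real s * \<zeta>) (at 0) (at_right (0::real))"
    using \<zeta> by (auto simp: filterlim_at eventually_at_right_field intro!: tendsto_eq_intros exI[of _ 1])
  ultimately have "((\<lambda>s. norm (f (of_real s * \<zeta>) / (of_real s * \<zeta>))) \<longlongrightarrow> norm (1::complex)) (at_right (0::real))"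
    by (intro tendsto_norm) (rule filterlim_compose)
  then have "((\<lambda>s. norm (g s / of_real s)) \<longlongrightarrow> 1) (at_right (0::real))"
    using \<zeta> by (simp add: g_def norm_divide norm_mult)
  moreover have "(Si \<longlongrightarrow> Si 0) (at_right 0)"
    using isCont_Si[of 0] unfolding isCont_def by (rule tendsto_within_subset) simp
  ultimately have "(\<psi> \<longlongrightarrow> 1\<^sup>2 * exp (- 2 * Si 0)) (at_right 0)"
    unfolding \<psi>_eq by (intro tendsto_intros)
  then have "(\<psi> \<longlongrightarrow> 1) (at_right 0)" by (simp add: Si_0)
  then have "\<psi> r \<le> 1"
    by (rule tendsto_lowerbound[OF _ ev]) simp
  moreover have "norm (g r / of_real r) = norm (f z) / r"
    using r by (simp add: g_def z_eq[symmetric] norm_divide)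
  moreover have "exp (- 2 * Si r) = 1 / (exp (Si r))\<^sup>2"
    using exp_minus[of "2 * Si r"] exp_double[of "Si r"] by (simp add: inverse_eq_divide)
  ultimately have "(norm (f z) / r)\<^sup>2 * (1 / (exp (Si r))\<^sup>2) \<le> 1"
    by (simp only: \<psi>_eq)
  then have "(norm (f z))\<^sup>2 \<le> (r * exp (Si r))\<^sup>2"
    using r by (simp add: power_divide power_mult_distrib pos_divide_le_eq)
  then have "norm (f z) \<le> r * exp (Si r)"
    by (rule power2_le_imp_le) (use r in simp)
  then show ?thesis by (simp add: r_def)
qed

section \<open>The radius estimate\<close>

lemma class_S_sin_norm_less:
  assumes f: "f \<in> class_S_sin" and z: "norm z < r0" and r0: "radius_fun r0 = 1" "r0 \<le> 3/5"
  shows "norm (z * deriv f z - f z) < 1 / 2"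
proof (cases "z = 0")
  case True
  then show ?thesis using f by (simp add: class_S_sin_def class_A_def)
next
  case False
  obtain \<omega> where \<omega>: "\<omega> holomorphic_on ball 0 1" "\<omega> ` ball 0 1 \<subseteq> ball 0 1" "\<omega> 0 = 0"
    "\<And>u. norm u < 1 \<Longrightarrow> starlike_quotient f u = 1 + sin (\<omega> u)"
    using f by (auto simp: class_S_sin_def subordinate_def unit_disc_def)
  have A: "f holomorphic_on ball 0 1" "f 0 = 0" "deriv f 0 = 1"
    using f by (auto simp: class_S_sin_def class_A_def unit_disc_def)
  have Schwarz: "norm (\<omega> u) \<le> norm u" if "norm u < 1" for u
    using Schwarz_Lemma(1)[OF \<omega>(1,3) _ that] \<omega>(2) by (auto simp: image_subset_iff)
  have sin_\<omega>: "norm (sin (\<omega> u)) \<le> sinh (norm u)" if "norm u < 1" for u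
    using norm_sin_le_sinh_norm[of "\<omega> u"] Schwarz[OF that] by (meson order_trans sinh_real_le_iff)
  \<comment> \<open>From exp x \<le> 1 + x + x^2 and exp (-x) \<ge> 1 - x. It keeps |sin (\<omega>
    u)| below 1, so the starlike quotient is nonzero.\<close>
  have sinh1: "sinh (3/5 :: real) < 1"
    using exp_bound[of "3/5 :: real"] exp_ge_add_one_self[of "- 3/5 :: real"]
    by (simp add: sinh_field_def power2_eq_square)
  have eq: "u * deriv f u = f u * (1 + sin (\<omega> u))" if u: "u \<noteq> 0" "norm u \<le> norm z" for u
  proof -
    have u1: "norm u \<le> 3/5" "norm u < 1" using u z r0 by linarith+
    have "norm (sin (\<omega> u)) < 1"
      using sin_\<omega>[OF u1(2)] u1(1) sinh1 by (smt (verit) sinh_real_le_iff)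
    then have "sin (\<omega> u) \<noteq> - 1" by auto
    then have "1 + sin (\<omega> u) \<noteq> 0" by (metis add_eq_0_iff)
    \<comment> \<open>A zero of f would give the quotient the default value 0; only after excluding
      it can the quotient be cleared.\<close>
    then have "f u \<noteq> 0" using \<omega>(4)[OF u1(2)] u by (auto simp: starlike_quotient_def)
    then show ?thesis
      using \<omega>(4)[OF u1(2)] u by (simp add: starlike_quotient_def field_simps)
  qed
  have growth: "norm (f z) \<le> norm z * exp (Si (norm z))"
  proof (rule norm_le_of_starlike_quotient[OF A False _ eq])
    show "Re (sin (\<omega> u)) \<le> sin (norm u)" if "norm u \<le> norm z" for u
      using that z r0 Schwarz[of u] by (intro Re_sin_le_sin) auto
  qed (use z r0 in auto)
  have "z * deriv f z - f z = f z * sin (\<omega> z)"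
    using eq[of z] False by (simp add: algebra_simps)
  then have "norm (z * deriv f z - f z) \<le> (norm z * exp (Si (norm z))) * sinh (norm z)"
    using growth sin_\<omega>[of z] z r0 by (simp add: norm_mult mult_mono)
  also have "\<dots> = radius_fun (norm z) / 2" by (simp add: radius_fun_def)
  also have "\<dots> < radius_fun r0 / 2" using radius_fun_strict_mono[of "norm z" r0] z r0 by simp
  finally show ?thesis using r0 by simp
qed

theorem theorem2p16:
  shows "\<exists>r0::real.
    smallest_positive_root (\<lambda>r. 2 * sinh (complex_of_real r) * f0 (complex_of_real r) - 1) r0 \<and>
    \<bar>r0 - 0.531721\<bar> < 5 / 10 ^ 7 \<and>
    (\<forall>f \<in> class_S_sin. f \<in> Omega_in_disc r0)"
proof -
  obtain r0 where r0: "radius_fun r0 = 1" "\<bar>r0 - 0.531721\<bar> < 5 / 10 ^ 7"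
    by (rule radius_fun_root)
  then have bounds: "0 < r0" "r0 \<le> 3/5" unfolding abs_less_iff by (auto simp: field_simps)
  \<comment> \<open>On the positive axis the complex equation is real, so monotonicity decides its
    roots.\<close>
  have eq: "2 * sinh (complex_of_real r) * f0 (complex_of_real r) - 1 = of_real (radius_fun r - 1)"
    if "0 < r" for r
    using that by (simp add: f0_of_real radius_fun_def sinh_field_def exp_of_real[symmetric] del: exp_of_real)
  have "radius_fun s \<noteq> 1" if "0 < s" "s < r0" for s
    using radius_fun_strict_mono[of s r0] that bounds r0 by auto
  then have "smallest_positive_root (\<lambda>r. 2 * sinh (complex_of_real r) * f0 (complex_of_real r) - 1) r0"
    unfolding smallest_positive_root_def using bounds r0 by (simp add: eq)
  moreover have "f \<in> Omega_in_disc r0" if "f \<in> class_S_sin" for f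
    using that class_S_sin_norm_less[OF that _ r0(1) bounds(2)]
    by (auto simp: Omega_in_disc_def class_S_sin_def)
  ultimately show ?thesis using r0 by blast
qed

end
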